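(* Let $k\ge 5$ be an integer and let $G$ be a graph with $n$ vertices. Then $G$ contains at most $\dfrac{2n^k}{k^k}$ induced copies of the cycle $C_k$ of length $k$.
   Context: Graphs are finite and simple. $C_k$ denotes the cycle with $k$ vertices. The number of induced copies of $C_k$ in $G$ is the number of $k$-element subsets $S\subseteq V(G)$ such that the subgraph of $G$ induced by $S$ is isomorphic to $C_k$. *)

theory Defs
  imports Complex_Main "Graph_Theory.Graph_Theory"
begin

text \<open>
  As in the library, a finite simple graph is a finite symmetric digraph without loops and
  parallel arcs (locale \<^locale>\<open>graph\<close>): the edge between \<open>u\<close> and \<open>v\<close> is the pair of
  arcs from \<open>u\<close> to \<open>v\<close> and from \<open>v\<close> to \<open>u\<close>.
\<close>

definition cycle_graph :: "nat \<Rightarrow> (nat, nat \<times> nat) pre_digraph" where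
  "cycle_graph k = with_proj
     \<lparr> pverts = {0..<k},
       parcs = {(i, j). i < k \<and> j < k \<and> (j = (i + 1) mod k \<or> i = (j + 1) mod k)} \<rparr>"

lemma graph_cycle_graph:
  assumes "3 \<le> k"
  shows "graph (cycle_graph k)"
proof -
  let ?C = "\<lparr> pverts = {0..<k},
    parcs = {(i, j). i < k \<and> j < k \<and> (j = (i + 1) mod k \<or> i = (j + 1) mod k)} \<rparr>"
  have fin: "finite (parcs ?C)"
    by (rule finite_subset[of _ "{0..<k} \<times> {0..<k}"]) auto
  have no_loop: "(i + 1) mod k \<noteq> i" if "i < k" for i
    using that assms by (cases "i + 1 = k") auto
  have "pair_graph ?C"
  proof
    show "finite (parcs ?C)" by (rule fin)
    show "symmetric (with_proj ?C)"
      by (auto simp: symmetric_def intro!: symI)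
    show "fst e \<noteq> snd e" if "e \<in> parcs ?C" for e
      using that no_loop by fastforce
  qed auto
  then show ?thesis
    unfolding cycle_graph_def by (rule pair_graph.pair_graphD_graph)
qed

definition induced_cycle_count :: "('a, 'b) pre_digraph \<Rightarrow> nat \<Rightarrow> nat" where
  "induced_cycle_count G k =
     card {S. S \<subseteq> verts G \<and> card S = k \<and> digraph_iso (G \<restriction> S) (cycle_graph k)}"

end

theory Submission
  imports Defs
begin

text \<open>
  The proof finds an induced cycle by a random greedy choice and bounds from below the
  probability that a given one is found.

  Choose vertices \<open>z\<^sub>0, z\<^sub>1, \<dots>\<close> one after another, each uniformly among the vertices whose
  adjacencies to the earlier ones are those of the next vertex along an induced \<open>k\<close>-cycle. A
  sequence with \<open>n\<^sub>i\<close> candidates at step \<open>i\<close> is chosen with probability \<open>\<Prod>i<k. 1 / n\<^sub>i\<close>, so these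
  weights sum to at most \<open>1\<close> over all sequences (\<open>sum_greedy_weight_le_1\<close>). An induced cycle
  can be traced in \<open>2 k\<close> ways, by \<open>k\<close> starting points and two directions, and different cycles
  give different sequences. Hence it suffices that the \<open>2 k\<close> tours of one cycle have total
  weight at least \<open>k ^ k / (2 n ^ k)\<close>; each direction provides half of this
  (\<open>sum_tour_weights_ge\<close>).

  There are \<open>n\<^sub>0 = n\<close> candidates for the start. Halve the counts \<open>n\<^sub>1\<close> and \<open>n\<^sub>2\<close>, at the price of
  a factor \<open>4\<close>. The key estimate is that the adjusted counts at the steps \<open>1, \<dots>, k - 1\<close>, summed
  over the \<open>k\<close> starting points of one direction, are at most \<open>n (k - 1)\<close>; so their average is
  at most \<open>n / k\<close>, and by convexity the average weight of a tour is at least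
  \<open>1 / (4 n) \<cdot> (k / n) ^ (k - 1)\<close>.

  The key estimate is proved for each vertex \<open>w\<close> separately: it should be a candidate at most
  \<open>k - 1\<close> times, counted with the factors \<open>1 / 2\<close> (\<open>sum_cyclic_hits_le\<close>). Whether it is one
  depends only on which positions of the cycle are neighbours of \<open>w\<close>. Leaving the closing step
  aside, a tour whose first two vertices include a neighbour of \<open>w\<close> counts \<open>w\<close> by \<open>1 / 2\<close>, and
  every other tour at most once, when it leaves the first neighbour of \<open>w\<close>. A single neighbour
  of \<open>w\<close> makes two of the starting points halves, which saves the required \<open>1\<close>. If moreover
  \<open>w\<close> closes some tour, then \<open>w\<close> is adjacent to two positions at distance two, four starting
  points are halves, and this pays for the closing step. For \<open>k \<ge> 5\<close> at most one starting point
  per direction has \<open>w\<close> as a closing vertex; in the four-cycle two opposite ones can.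
\<close>

section \<open>Weights of a sequential choice\<close>

definition greedy :: "('a list \<Rightarrow> 'a set) \<Rightarrow> nat \<Rightarrow> 'a list set" where
  "greedy A m = {xs. length xs = m \<and> (\<forall>i<m. xs ! i \<in> A (take i xs))}"

definition greedy_weight :: "('a list \<Rightarrow> 'a set) \<Rightarrow> 'a list \<Rightarrow> real" where
  "greedy_weight A xs = (\<Prod>i<length xs. 1 / real (card (A (take i xs))))"

lemma greedy_0: "greedy A 0 = {[]}"
  by (auto simp: greedy_def)

lemma greedy_Suc: "greedy A (Suc m) = (\<lambda>(xs, x). xs @ [x]) ` (SIGMA xs:greedy A m. A xs)"
proof (intro equalityI subsetI)
  fix ys assume ys: "ys \<in> greedy A (Suc m)"
  then have len: "length ys = Suc m" and step: "\<And>i. i < Suc m \<Longrightarrow> ys ! i \<in> A (take i ys)"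
    by (auto simp: greedy_def)
  have "take m ys \<in> greedy A m"
    using len step by (auto simp: greedy_def min_def)
  moreover have "ys ! m \<in> A (take m ys)" using step by simp
  moreover have "ys = take m ys @ [ys ! m]"
    using len by (metis lessI take_Suc_conv_app_nth take_all order_refl)
  ultimately show "ys \<in> (\<lambda>(xs, x). xs @ [x]) ` (SIGMA xs:greedy A m. A xs)"
    by (auto intro!: rev_image_eqI[of "(take m ys, ys ! m)"])
next
  fix ys assume "ys \<in> (\<lambda>(xs, x). xs @ [x]) ` (SIGMA xs:greedy A m. A xs)"
  then show "ys \<in> greedy A (Suc m)"
    by (auto simp: greedy_def nth_append less_Suc_eq)
qed

lemma finite_greedy:
  assumes "\<And>xs. finite (A xs)"
  shows "finite (greedy A m)"
  by (induction m) (auto simp: greedy_0 greedy_Suc assms)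

text \<open>
  Extending a sequence by one of its \<open>d\<close> candidates divides the weight by \<open>d\<close>, so one more step
  preserves the total weight, except that sequences without candidates lose theirs.
\<close>

lemma sum_greedy_weight_le_1:
  assumes "\<And>xs. finite (A xs)"
  shows "(\<Sum>xs\<in>greedy A m. greedy_weight A xs) \<le> 1"
proof (induction m)
  case 0
  then show ?case by (simp add: greedy_0 greedy_weight_def)
next
  case (Suc m)
  have inj: "inj_on (\<lambda>(xs, x). xs @ [x]) (SIGMA xs:greedy A m. A xs)"
    by (auto simp: inj_on_def)
  have snoc: "greedy_weight A (xs @ [x]) = greedy_weight A xs * (1 / real (card (A xs)))" for xs x
    by (auto simp: greedy_weight_def intro!: prod.cong)
  have "(\<Sum>ys\<in>greedy A (Suc m). greedy_weight A ys)
      = (\<Sum>(xs, x)\<in>(SIGMA xs:greedy A m. A xs). greedy_weight A (xs @ [x]))"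
    unfolding greedy_Suc by (subst sum.reindex[OF inj]) (simp add: case_prod_unfold)
  also have "\<dots> = (\<Sum>xs\<in>greedy A m. \<Sum>x\<in>A xs. greedy_weight A (xs @ [x]))"
    by (rule sum.Sigma[symmetric]) (auto simp: finite_greedy assms)
  also have "\<dots> \<le> (\<Sum>xs\<in>greedy A m. greedy_weight A xs)"
  proof (rule sum_mono)
    fix xs
    have "greedy_weight A xs \<ge> 0" by (simp add: greedy_weight_def prod_nonneg)
    then show "(\<Sum>x\<in>A xs. greedy_weight A (xs @ [x])) \<le> greedy_weight A xs"
      by (simp add: snoc)
  qed
  finally show ?case using Suc.IH by linarith
qed

text \<open>
  The tangent plane at \<open>y = 1\<close> of a convex function. It replaces the inequality between
  arithmetic and geometric means: summed over all tours it needs only the sum of all the \<open>y\<close>.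
\<close>

lemma prod_inverse_ge:
  fixes y :: "'i \<Rightarrow> real"
  assumes "finite I" and pos: "\<And>i. i \<in> I \<Longrightarrow> 0 < y i"
  shows "(\<Prod>i\<in>I. inverse (y i)) \<ge> 1 + (\<Sum>i\<in>I. 1 - y i)"
proof -
  have "1 + (\<Sum>i\<in>I. 1 - y i) \<le> exp (\<Sum>i\<in>I. 1 - y i)"
    by (rule exp_ge_add_one_self)
  also have "\<dots> = (\<Prod>i\<in>I. exp (1 - y i))"
    using assms(1) by (simp add: exp_sum)
  also have "\<dots> \<le> (\<Prod>i\<in>I. inverse (y i))"
  proof (rule prod_mono, safe)
    fix i assume "i \<in> I"
    have "y i \<le> exp (y i - 1)" using exp_ge_add_one_self[of "y i - 1"] by simp
    then have "inverse (exp (y i - 1)) \<le> inverse (y i)"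
      using pos[OF \<open>i \<in> I\<close>] by (intro le_imp_inverse_le) auto
    then show "exp (1 - y i) \<le> inverse (y i)" by (simp add: exp_minus[symmetric])
  qed simp
  finally show ?thesis .
qed

section \<open>A vertex seen from a cycle\<close>

text \<open>
  Here \<open>P j\<close> says that a fixed vertex \<open>w\<close> is adjacent to position \<open>j\<close> of a cycle; positions are
  integers, and \<open>P\<close> has period \<open>k\<close>.
\<close>

lemma sum_periodic_window:
  fixes f :: "int \<Rightarrow> real"
  assumes per: "\<And>j. f (j + int k) = f j"
  shows "(\<Sum>j\<in>{a..<a + int k}. f j) = (\<Sum>j\<in>{0..<int k}. f j)"
proof -
  have step: "(\<Sum>j\<in>{a + 1..<a + 1 + int k}. f j) = (\<Sum>j\<in>{a..<a + int k}. f j)" for a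
  proof (cases "k = 0")
    case False
    then have "{a..<a + int k} = insert a {a + 1..<a + int k}"
      and "{a + 1..<a + 1 + int k} = insert (a + int k) {a + 1..<a + int k}" by auto
    then show ?thesis by (simp add: per)
  qed simp
  show ?thesis
  proof (induction a rule: int_induct[where k = 0])
    case (step1 i)
    then show ?case using step[of i] by simp
  next
    case (step2 i)
    then show ?case using step[of "i - 1"] by simp
  qed simp
qed

text \<open>
  The vertex \<open>w\<close> is a candidate at step \<open>i\<close> of the tour that starts at position \<open>j\<close>: among the
  positions already visited it is adjacent to the last one, and at the closing step
  \<open>i = k - 1\<close> also to the first one.
\<close>

definition cyclic_hit :: "nat \<Rightarrow> (int \<Rightarrow> bool) \<Rightarrow> int \<Rightarrow> nat \<Rightarrow> bool" where
  "cyclic_hit k P j i \<longleftrightarrow> (\<forall>l<i. P (j + int l) \<longleftrightarrow> Suc l = i \<or> l = 0 \<and> Suc i = k)"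

lemma cyclic_hitD:
  "cyclic_hit k P j i \<Longrightarrow> l < i \<Longrightarrow> P (j + int l) \<longleftrightarrow> Suc l = i \<or> l = 0 \<and> Suc i = k"
  by (simp add: cyclic_hit_def)

text \<open>
  The factors are dictated by the balanced blow-up of \<open>C\<^sub>k\<close> with independent classes of size
  \<open>n / k\<close>. There the steps \<open>1\<close> and \<open>2\<close> have candidates in two classes (either direction, and then
  also the class of the start), all later steps in one. With the factors all adjusted counts
  are \<open>n / k\<close>, which is what averaging by convexity needs.
\<close>

definition step_coeff :: "nat \<Rightarrow> real" where
  "step_coeff i = (if i \<le> 2 then 1/2 else 1)"

text \<open>
  A middle step counts \<open>w\<close> only if the position just left is the first neighbour of \<open>w\<close> on the
  tour, so it happens at most once, and not if this neighbour is one of the first two positions.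
  In the latter case exactly one of the steps \<open>1\<close> and \<open>2\<close> counts \<open>w\<close>, by \<open>1 / 2\<close>.
\<close>

lemma sum_step_hits_le:
  assumes "5 \<le> k"
  shows "(\<Sum>i\<in>{1..<k}. step_coeff i * of_bool (cyclic_hit k P j i))
      \<le> 1 - of_bool (P j \<or> P (j + 1)) / 2 + of_bool (cyclic_hit k P j (k - 1))"
proof -
  (* the middle steps that count w: all but the two halved ones and the closing one *)
  define M where "M = {i\<in>{3..<k - 1}. cyclic_hit k P j i}"
  have split: "{1..<k} = insert 1 (insert 2 (insert (k - 1) {3..<k - 1}))" using assms by auto
  have "(\<Sum>i\<in>{1..<k}. step_coeff i * of_bool (cyclic_hit k P j i))
      = of_bool (cyclic_hit k P j 1) / 2 + of_bool (cyclic_hit k P j 2) / 2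
        + of_bool (cyclic_hit k P j (k - 1))
        + (\<Sum>i\<in>{3..<k - 1}. step_coeff i * of_bool (cyclic_hit k P j i))"
    unfolding split using assms by (subst sum.insert; auto simp: step_coeff_def)+
  also have "(\<Sum>i\<in>{3..<k - 1}. step_coeff i * of_bool (cyclic_hit k P j i))
      = (\<Sum>i\<in>{3..<k - 1}. of_bool (cyclic_hit k P j i))"
    by (intro sum.cong) (auto simp: step_coeff_def)
  also have "\<dots> = real (card M)"
    by (simp add: M_def sum.If_cases of_bool_def Int_def)
  also have "cyclic_hit k P j 1 \<longleftrightarrow> P j" by (simp add: cyclic_hit_def)
  also have "cyclic_hit k P j 2 \<longleftrightarrow> \<not> P j \<and> P (j + 1)"
    using assms by (auto simp: cyclic_hit_def less_Suc_eq numeral_2_eq_2)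
  finally have eq: "(\<Sum>i\<in>{1..<k}. step_coeff i * of_bool (cyclic_hit k P j i))
      = of_bool (P j) / 2 + of_bool (\<not> P j \<and> P (j + 1)) / 2
        + of_bool (cyclic_hit k P j (k - 1)) + real (card M)" .
  have no_start: "\<not> P j \<and> \<not> P (j + 1)" if "i \<in> M" for i
  proof -
    have "cyclic_hit k P j i" "3 \<le> i" "i < k - 1" using that by (auto simp: M_def)
    then show ?thesis using cyclic_hitD[of k P j i 0] cyclic_hitD[of k P j i 1] by auto
  qed
  have "i = i'" if "i \<in> M" "i' \<in> M" for i i'
  proof -
    have False if "i \<in> M" "i' \<in> M" "i < i'" for i i'
    proof -
      have h: "cyclic_hit k P j i" "cyclic_hit k P j i'" "3 \<le> i" "i' < k - 1"
        using that by (auto simp: M_def)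
      have "P (j + int (i - 1))"
        using cyclic_hitD[OF h(1), of "i - 1"] h(3) by simp
      moreover have "\<not> P (j + int (i - 1))"
        using cyclic_hitD[OF h(2), of "i - 1"] h(3) \<open>i < i'\<close> by simp
      ultimately show False by simp
    qed
    with that show ?thesis by (metis nat_neq_iff)
  qed
  then have "card M \<le> 1" by (auto simp: M_def card_le_Suc0_iff_eq)
  moreover have "card M = 0" if "P j \<or> P (j + 1)"
  proof -
    have "M = {}" using no_start that by auto
    then show ?thesis by simp
  qed
  ultimately show ?thesis unfolding eq by auto
qed

text \<open>
  If the tour from \<open>j\<close> is closed by \<open>w\<close>, then \<open>w\<close> is adjacent to \<open>j\<close> and \<open>j - 2\<close>, and its only
  other possible neighbour on the cycle is \<open>j - 1\<close>. For \<open>k \<ge> 5\<close> these three consecutive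
  positions contain no other pair \<open>j', j' - 2\<close> modulo \<open>k\<close>.
\<close>

lemma sum_closing_hits_le:
  assumes "5 \<le> k" and per: "\<And>j. P (j + int k) = P j"
  shows "(\<Sum>j\<in>{0..<int k}. of_bool (cyclic_hit k P j (k - 1)) :: real) \<le> 1"
proof (cases "\<exists>j. cyclic_hit k P j (k - 1)")
  case False
  then show ?thesis by simp
next
  case True
  then obtain j where j: "cyclic_hit k P j (k - 1)" by blast
  have unique: "j' = j" if "cyclic_hit k P j' (k - 1)" "j \<le> j'" "j' < j + int k" for j'
  proof (rule ccontr)
    assume "j' \<noteq> j"
    have off: "\<not> P x" if "j' + 1 \<le> x" "x \<le> j' + int k - 3" for x
    proof -
      have "nat (x - j') < k - 1" "Suc (nat (x - j')) \<noteq> k - 1" "nat (x - j') \<noteq> 0"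
        using that assms(1) by linarith+
      then have "\<not> P (j' + int (nat (x - j')))"
        using cyclic_hitD[OF \<open>cyclic_hit k P j' (k - 1)\<close>, of "nat (x - j')"] by simp
      moreover have "j' + int (nat (x - j')) = x" using that by simp
      ultimately show ?thesis by simp
    qed
    have "P (j + int 0)" "P (j + int (k - 2))"
      using assms(1) cyclic_hitD[OF j, of 0] cyclic_hitD[OF j, of "k - 2"] by auto
    then have "P (j + int k)" "P (j + int k - 2)"
      using per assms(1) by (simp_all add: of_nat_diff algebra_simps)
    with off[of "j + int k"] off[of "j + int k - 2"] that \<open>j' \<noteq> j\<close> assms(1)
    show False by linarith
  qed
  have per': "cyclic_hit k P (i + int k) m = cyclic_hit k P i m" for i m
  proof -
    have "P (i + int k + int l) = P (i + int l)" for l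
      using per[of "i + int l"] by (simp add: algebra_simps)
    then show ?thesis by (simp add: cyclic_hit_def)
  qed
  have "(\<Sum>j\<in>{0..<int k}. of_bool (cyclic_hit k P j (k - 1)) :: real)
      = (\<Sum>j'\<in>{j..<j + int k}. of_bool (cyclic_hit k P j' (k - 1)))"
    by (rule sum_periodic_window[symmetric]) (simp add: per')
  also have "\<dots> \<le> (\<Sum>j'\<in>{j..<j + int k}. of_bool (j' = j))"
    using unique by (intro sum_mono) auto
  also have "\<dots> \<le> 1"
    using card_mono[of "{j}" "{j..<j + int k} \<inter> {j}"] by simp
  finally show ?thesis .
qed

text \<open>
  A form of the window lemma that allows to exhibit starting points around a position of
  interest without reducing them modulo \<open>k\<close>.
\<close>

lemma sum_covered_ge:
  fixes k :: nat
  assumes per: "\<And>j. P (j + int k) = P j" and "B \<subseteq> {a..<a + int k}"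
    and "\<And>j. j \<in> B \<Longrightarrow> P j \<or> P (j + 1)"
  shows "real (card B) \<le> (\<Sum>j\<in>{0..<int k}. of_bool (P j \<or> P (j + 1)))"
proof -
  have fin: "finite B" using assms(2) finite_subset by blast
  have per': "P (j + int k + 1) = P (j + 1)" for j
    using per[of "j + 1"] by (simp add: algebra_simps)
  have "real (card B) = (\<Sum>j\<in>B. of_bool (P j \<or> P (j + 1)))"
    using assms(3) by simp
  also have "\<dots> \<le> (\<Sum>j\<in>{a..<a + int k}. of_bool (P j \<or> P (j + 1)))"
    using assms(2) by (intro sum_mono2) auto
  also have "\<dots> = (\<Sum>j\<in>{0..<int k}. of_bool (P j \<or> P (j + 1)))"
    by (rule sum_periodic_window) (simp add: per per')
  finally show ?thesis .
qed

text \<open>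
  By the bound for a single start, it remains to see that the number of starts with a
  neighbour of \<open>w\<close> among their first two positions is at least \<open>2\<close>, and at least \<open>4\<close> if \<open>w\<close>
  closes some tour.
\<close>

lemma sum_cyclic_hits_le:
  assumes k: "5 \<le> k" and per: "\<And>j. P (j + int k) = P j"
  shows "(\<Sum>j\<in>{0..<int k}. \<Sum>i\<in>{1..<k}. step_coeff i * of_bool (cyclic_hit k P j i))
      \<le> real k - 1"
proof (cases "\<exists>j. P j")
  case False
  then have "\<not> cyclic_hit k P j i" if "i \<ge> 1" for i j
    using that by (auto simp: cyclic_hit_def intro!: exI[of _ "i - 1"])
  then show ?thesis using k by simp
next
  case True
  then obtain j0 where j0: "P j0" by blast
  let ?cov = "(\<Sum>j\<in>{0..<int k}. of_bool (P j \<or> P (j + 1))) :: real"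
  let ?cl = "(\<Sum>j\<in>{0..<int k}. of_bool (cyclic_hit k P j (k - 1))) :: real"
  have "(\<Sum>j\<in>{0..<int k}. \<Sum>i\<in>{1..<k}. step_coeff i * of_bool (cyclic_hit k P j i))
      \<le> (\<Sum>j\<in>{0..<int k}. 1 - of_bool (P j \<or> P (j + 1)) / 2
            + of_bool (cyclic_hit k P j (k - 1)))"
    by (intro sum_mono sum_step_hits_le k)
  also have "\<dots> = real k - ?cov / 2 + ?cl"
    by (simp only: sum.distrib sum_subtractf sum_divide_distrib[symmetric]) simp
  finally have le: "(\<Sum>j\<in>{0..<int k}. \<Sum>i\<in>{1..<k}. step_coeff i * of_bool (cyclic_hit k P j i))
      \<le> real k - ?cov / 2 + ?cl" .
  have "?cov \<ge> 2 + 2 * ?cl"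
  proof (cases "\<exists>j. cyclic_hit k P j (k - 1)")
    case False
    then have "?cl = 0" by simp
    moreover have "real (card {j0 - 1, j0}) \<le> ?cov"
      by (rule sum_covered_ge[where P = P and a = "j0 - 1", OF per]) (use k j0 in auto)
    ultimately show ?thesis by simp
  next
    case True
    then obtain j where j: "cyclic_hit k P j (k - 1)" by blast
    have "P (j + int 0)" "P (j + int (k - 2))"
      using k cyclic_hitD[OF j, of 0] cyclic_hitD[OF j, of "k - 2"] by auto
    then have P: "P j" "P (j - 2)"
      using per[of "j - 2"] k by (simp_all add: of_nat_diff algebra_simps)
    (* j - 3 and j - 2 are covered by the neighbour j - 2, and j - 1 and j by the neighbour j *)
    have "real (card {j - 3, j - 2, j - 1, j}) \<le> ?cov"
      by (rule sum_covered_ge[where P = P and a = "j - 3", OF per]) (use k P in auto)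
    moreover have "?cl \<le> 1" by (rule sum_closing_hits_le[where P = P, OF k per])
    ultimately show ?thesis by simp
  qed
  with le show ?thesis by linarith
qed

section \<open>Tours of an induced cycle\<close>

text \<open>
  The candidates for the next vertex of an induced \<open>k\<close>-cycle traced as \<open>xs\<close> so far. A vertex of
  \<open>xs\<close> itself may be a candidate; this is harmless because the bounds treat all vertices alike.
\<close>

definition extensions :: "'a set \<Rightarrow> 'a rel \<Rightarrow> nat \<Rightarrow> 'a list \<Rightarrow> 'a set" where
  "extensions V E k xs =
     {w \<in> V. \<forall>l<length xs. (w, xs ! l) \<in> E \<longleftrightarrow>
        Suc l = length xs \<or> l = 0 \<and> Suc (length xs) = k}"

text \<open>
  Labels are integers read modulo \<open>k\<close>, so that rotations and the reflection of a labelling are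
  the substitutions \<open>i \<mapsto> j + i\<close> and \<open>i \<mapsto> - i\<close>.
\<close>

definition cyclic_labelling :: "'a rel \<Rightarrow> nat \<Rightarrow> (int \<Rightarrow> 'a) \<Rightarrow> bool" where
  "cyclic_labelling E k c \<longleftrightarrow>
     (\<forall>i j. c i = c j \<longleftrightarrow> i mod int k = j mod int k) \<and>
     (\<forall>i j. (c i, c j) \<in> E \<longleftrightarrow> (i - j) mod int k = 1 \<or> (j - i) mod int k = 1)"

definition tour :: "(int \<Rightarrow> 'a) \<Rightarrow> int \<Rightarrow> nat \<Rightarrow> 'a list" where
  "tour c j m = map (\<lambda>i. c (j + int i)) [0..<m]"

lemma length_tour [simp]: "length (tour c j m) = m"
  by (simp add: tour_def)

lemma nth_tour [simp]: "i < m \<Longrightarrow> tour c j m ! i = c (j + int i)"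
  by (simp add: tour_def)

lemma take_tour [simp]: "i \<le> m \<Longrightarrow> take i (tour c j m) = tour c j i"
  by (simp add: tour_def take_map)

lemma cyclic_labelling_periodic: "cyclic_labelling E k c \<Longrightarrow> c (j + int k) = c j"
  by (simp add: cyclic_labelling_def)

lemma cyclic_labelling_reflect:
  assumes "cyclic_labelling E k c"
  shows "cyclic_labelling E k (\<lambda>i. c (- i))"
proof -
  have "(- i) mod int k = (- j) mod int k \<longleftrightarrow> i mod int k = j mod int k" for i j
    by (simp add: mod_eq_dvd_iff dvd_diff_commute)
  then show ?thesis using assms by (auto simp: cyclic_labelling_def algebra_simps)
qed

lemma tour_step:
  assumes c: "cyclic_labelling E k c" and V: "range c \<subseteq> V" and "i < k" "3 \<le> k"
  shows "c (j + int i) \<in> extensions V E k (tour c j i)"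
proof -
  have "(c (j + int i), c (j + int l)) \<in> E \<longleftrightarrow> Suc l = i \<or> l = 0 \<and> Suc i = k" if "l < i" for l
  proof -
    have "(int i - int l) mod int k = int i - int l"
      using that assms(3) by (intro mod_pos_pos_trivial) auto
    moreover have "(int l - int i) mod int k = int l - int i + int k"
    proof -
      have "(int l - int i) mod int k = (int l - int i + int k) mod int k" by simp
      also have "\<dots> = int l - int i + int k"
        using that assms(3) by (intro mod_pos_pos_trivial) auto
      finally show ?thesis .
    qed
    ultimately have "(c (j + int i), c (j + int l)) \<in> E \<longleftrightarrow>
        int i - int l = 1 \<or> int l - int i + int k = 1"
      using c by (auto simp: cyclic_labelling_def)
    also have "\<dots> \<longleftrightarrow> Suc l = i \<or> l = 0 \<and> Suc i = k"
      using that assms(3,4) by auto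
    finally show ?thesis .
  qed
  then show ?thesis using V by (auto simp: extensions_def)
qed

lemma tour_greedy:
  assumes "cyclic_labelling E k c" "range c \<subseteq> V" "3 \<le> k"
  shows "tour c j k \<in> greedy (extensions V E k) k"
  using tour_step[OF assms(1,2) _ assms(3)] by (auto simp: greedy_def)

lemma set_tour:
  assumes "cyclic_labelling E k c" "0 < k"
  shows "set (tour c j k) = range c"
proof -
  have "c i \<in> set (tour c j k)" for i
  proof -
    have "(j + int (nat ((i - j) mod int k))) mod int k = i mod int k"
      using assms(2) by (simp add: mod_add_right_eq)
    then have "c i = c (j + int (nat ((i - j) mod int k)))"
      using assms(1) by (simp add: cyclic_labelling_def)
    moreover have "nat ((i - j) mod int k) < k" using assms(2)
      by (simp add: nat_less_iff)
    ultimately show ?thesis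
      using nth_mem[of "nat ((i - j) mod int k)" "tour c j k"] by simp
  qed
  then show ?thesis by (auto simp: tour_def)
qed

lemma card_extensions_tour:
  assumes "finite V"
  shows "real (card (extensions V E k (tour c j i)))
      = (\<Sum>w\<in>V. of_bool (cyclic_hit k (\<lambda>x. (w, c x) \<in> E) j i))"
proof -
  have "extensions V E k (tour c j i) = {w\<in>V. cyclic_hit k (\<lambda>x. (w, c x) \<in> E) j i}"
    by (auto simp: extensions_def cyclic_hit_def)
  then show ?thesis
    using assms by (simp add: sum.If_cases of_bool_def Int_def)
qed

text \<open>
  Double counting of the pairs of a step and a candidate, vertex by vertex.
\<close>

lemma sum_card_extensions_tours_le:
  assumes k: "5 \<le> k" and fin: "finite V" and c: "cyclic_labelling E k c"
  shows "(\<Sum>j\<in>{0..<int k}. \<Sum>i\<in>{1..<k}.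
      step_coeff i * real (card (extensions V E k (tour c j i)))) \<le> real (card V) * (real k - 1)"
proof -
  let ?h = "\<lambda>w j i. step_coeff i * of_bool (cyclic_hit k (\<lambda>x. (w, c x) \<in> E) j i) :: real"
  have "(\<Sum>j\<in>{0..<int k}. \<Sum>i\<in>{1..<k}.
      step_coeff i * real (card (extensions V E k (tour c j i))))
      = (\<Sum>j\<in>{0..<int k}. \<Sum>i\<in>{1..<k}. \<Sum>w\<in>V. ?h w j i)"
    by (simp add: card_extensions_tour[OF fin] sum_distrib_left)
  also have "\<dots> = (\<Sum>j\<in>{0..<int k}. \<Sum>w\<in>V. \<Sum>i\<in>{1..<k}. ?h w j i)"
    by (intro sum.cong refl sum.swap)
  also have "\<dots> = (\<Sum>w\<in>V. \<Sum>j\<in>{0..<int k}. \<Sum>i\<in>{1..<k}. ?h w j i)"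
    by (rule sum.swap)
  also have "\<dots> \<le> (\<Sum>w\<in>V. real k - 1)"
    by (intro sum_mono sum_cyclic_hits_le k) (simp add: cyclic_labelling_periodic[OF c])
  finally show ?thesis by simp
qed

text \<open>
  The adjusted counts are rescaled by \<open>k / n\<close> to numbers \<open>y j i\<close> with average at most \<open>1\<close>. Then
  each weight is \<open>K\<close> times a product of inverses of these, where \<open>K\<close> is the weight a tour would
  have if all the \<open>y j i\<close> were \<open>1\<close>, and the tangent plane bound gives an average of at least \<open>K\<close>.
\<close>

lemma sum_tour_weights_ge:
  assumes k: "5 \<le> k" and fin: "finite V" and c: "cyclic_labelling E k c" and V: "range c \<subseteq> V"
  shows "(\<Sum>j\<in>{0..<int k}. greedy_weight (extensions V E k) (tour c j k))
      \<ge> real k ^ k / (4 * real (card V) ^ k)"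
proof -
  define n where "n = card V"
  define N where "N j i = real (card (extensions V E k (tour c j i)))" for j i
  define y where "y j i = step_coeff i * N j i * (real k / real n)" for j i
  have "n > 0" using V fin by (auto simp: n_def card_gt_0_iff)
  have Npos: "N j i > 0" if "i < k" for j i
  proof -
    have "c (j + int i) \<in> extensions V E k (tour c j i)"
      using tour_step[OF c V that] k by simp
    then show ?thesis using fin by (auto simp: N_def card_gt_0_iff extensions_def)
  qed
  have N0: "N j 0 = real n" for j
    by (simp add: N_def extensions_def n_def)
  have ypos: "y j i > 0" if "i < k" for j i
    using Npos[OF that] \<open>n > 0\<close> k by (simp add: y_def step_coeff_def)
  have coeff: "(\<Prod>i\<in>{1..<k}. step_coeff i) = 1/4"
  proof -
    have "{1..<k} = insert 1 (insert 2 {3..<k})" using k by auto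
    moreover have "(\<Prod>i\<in>{3..<k}. step_coeff i) = 1"
      by (intro prod.neutral) (auto simp: step_coeff_def)
    ultimately show ?thesis by (simp add: step_coeff_def)
  qed
  define K where "K = (real k / real n) ^ (k - 1) / (4 * real n)"
  have weight: "greedy_weight (extensions V E k) (tour c j k)
      = K * (\<Prod>i\<in>{1..<k}. inverse (y j i))" for j
  proof -
    have "greedy_weight (extensions V E k) (tour c j k) = (\<Prod>i<k. 1 / N j i)"
      unfolding greedy_weight_def N_def by (intro prod.cong) auto
    also have "{..<k} = insert 0 {1..<k}" using k by auto
    also have "(\<Prod>i\<in>insert 0 {1..<k}. 1 / N j i) = 1 / real n * (\<Prod>i\<in>{1..<k}. 1 / N j i)"
      by (simp add: N0)
    also have "(\<Prod>i\<in>{1..<k}. 1 / N j i)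
        = (\<Prod>i\<in>{1..<k}. step_coeff i * (real k / real n) * inverse (y j i))"
    proof (intro prod.cong refl)
      fix i assume "i \<in> {1..<k}"
      then have "N j i > 0" using Npos by simp
      then show "1 / N j i = step_coeff i * (real k / real n) * inverse (y j i)"
        using \<open>n > 0\<close> k by (simp add: y_def step_coeff_def field_simps)
    qed
    also have "\<dots> = 1/4 * (real k / real n) ^ (k - 1) * (\<Prod>i\<in>{1..<k}. inverse (y j i))"
      by (simp only: prod.distrib coeff prod_constant card_atLeastLessThan)
    finally show ?thesis by (simp add: K_def)
  qed
  have "real k \<le> (\<Sum>j\<in>{0..<int k}. 1 + (\<Sum>i\<in>{1..<k}. 1 - y j i))"
  proof -
    have "(\<Sum>j\<in>{0..<int k}. \<Sum>i\<in>{1..<k}. y j i)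
        = (\<Sum>j\<in>{0..<int k}. \<Sum>i\<in>{1..<k}. step_coeff i * N j i) * (real k / real n)"
      by (simp only: y_def sum_distrib_right)
    also have "\<dots> \<le> real n * (real k - 1) * (real k / real n)"
      using sum_card_extensions_tours_le[OF k fin c]
      by (intro mult_right_mono) (auto simp: N_def n_def)
    also have "\<dots> = real k * (real k - 1)" using \<open>n > 0\<close> by simp
    finally have "(\<Sum>j\<in>{0..<int k}. \<Sum>i\<in>{1..<k}. y j i) \<le> real k * (real k - 1)" .
    moreover have "(\<Sum>j\<in>{0..<int k}. 1 + (\<Sum>i\<in>{1..<k}. 1 - y j i))
        = real k + real k * (real k - 1) - (\<Sum>j\<in>{0..<int k}. \<Sum>i\<in>{1..<k}. y j i)"
      using k by (simp add: sum.distrib sum_subtractf of_nat_diff algebra_simps)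
    ultimately show ?thesis by linarith
  qed
  also have "\<dots> \<le> (\<Sum>j\<in>{0..<int k}. \<Prod>i\<in>{1..<k}. inverse (y j i))"
    using ypos by (intro sum_mono prod_inverse_ge) auto
  finally have "K * real k \<le> K * (\<Sum>j\<in>{0..<int k}. \<Prod>i\<in>{1..<k}. inverse (y j i))"
    by (intro mult_left_mono) (auto simp: K_def)
  also have "\<dots> = (\<Sum>j\<in>{0..<int k}. greedy_weight (extensions V E k) (tour c j k))"
    by (simp add: weight sum_distrib_left)
  also have "K * real k = real k ^ k / (4 * real n ^ k)"
  proof -
    have "real k ^ k = real k ^ (k - 1) * real k" "real n ^ k = real n ^ (k - 1) * real n"
      using k power_minus_mult[of k "real k"] power_minus_mult[of k "real n"] by simp_all
    then show ?thesis by (simp add: K_def power_divide)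
  qed
  finally show ?thesis by (simp add: n_def)
qed

lemma inj_on_tour:
  assumes "cyclic_labelling E k c" "0 < k"
  shows "inj_on (\<lambda>j. tour c j k) {0..<int k}"
proof (rule inj_onI)
  fix i j assume ij: "i \<in> {0..<int k}" "j \<in> {0..<int k}" "tour c i k = tour c j k"
  then have "tour c i k ! 0 = tour c j k ! 0" by simp
  then have "c i = c j" using assms(2) by simp
  then show "i = j" using assms(1) ij(1,2) by (auto simp: cyclic_labelling_def)
qed

text \<open>
  Two coinciding tours in opposite directions would agree in their first two vertices, which
  forces the step \<open>1\<close> to equal the step \<open>- 1\<close> modulo \<open>k\<close>.
\<close>

lemma tour_neq_reflected_tour:
  assumes c: "cyclic_labelling E k c" and k: "3 \<le> k"
  shows "tour c i k \<noteq> tour (\<lambda>x. c (- x)) j k"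
proof
  assume eq: "tour c i k = tour (\<lambda>x. c (- x)) j k"
  have "c (i + int l) = c (- (j + int l))" if "l < k" for l
    using arg_cong[OF eq, of "\<lambda>xs. xs ! l"] that by simp
  from this[of 0] this[of 1] have "i mod int k = (- j) mod int k"
      "(i + 1) mod int k = (- (j + 1)) mod int k"
    using c k by (auto simp: cyclic_labelling_def)
  then have "int k dvd i + j" "int k dvd i + j + 2"
    by (simp_all add: mod_eq_dvd_iff algebra_simps)
  then have "int k dvd 2" by (simp add: dvd_add_right_iff)
  then show False using k by (auto dest!: zdvd_imp_le)
qed

text \<open>
  Grouping the sequences by their vertex set makes the families of different cycles disjoint
  without choosing a labelling for each cycle.
\<close>

lemma sum_weights_of_cycle_ge:
  assumes k: "5 \<le> k" and fin: "finite V" and c: "cyclic_labelling E k c" and V: "range c \<subseteq> V"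
  shows "(\<Sum>xs\<in>{xs \<in> greedy (extensions V E k) k. set xs = range c}.
      greedy_weight (extensions V E k) xs) \<ge> real k ^ k / (2 * real (card V) ^ k)"
proof -
  let ?w = "greedy_weight (extensions V E k)"
  let ?r = "\<lambda>x. c (- x)"
  let ?T = "{xs \<in> greedy (extensions V E k) k. set xs = range c}"
  let ?A = "(\<lambda>j. tour c j k) ` {0..<int k}" and ?B = "(\<lambda>j. tour ?r j k) ` {0..<int k}"
  have r: "cyclic_labelling E k ?r" by (rule cyclic_labelling_reflect[OF c])
  have range_r: "range ?r = range c"
    by (metis (no_types, lifting) image_comp comp_def surj_def add.inverse_inverse image_cong)
  have fin_ext: "finite (extensions V E k xs)" for xs
    using fin by (simp add: extensions_def)
  have sub: "?A \<union> ?B \<subseteq> ?T"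
    using tour_greedy[OF c V] tour_greedy[OF r] set_tour[OF c] set_tour[OF r] range_r k V by auto
  have disj: "?A \<inter> ?B = {}"
    using tour_neq_reflected_tour[OF c] k by auto
  have "real k ^ k / (2 * real (card V) ^ k)
      = real k ^ k / (4 * real (card V) ^ k) + real k ^ k / (4 * real (card V) ^ k)"
    by simp
  also have "\<dots> \<le> (\<Sum>j\<in>{0..<int k}. ?w (tour c j k)) + (\<Sum>j\<in>{0..<int k}. ?w (tour ?r j k))"
    using sum_tour_weights_ge[OF k fin c V] sum_tour_weights_ge[OF k fin r] range_r V
    by (intro add_mono) auto
  also have "\<dots> = sum ?w ?A + sum ?w ?B"
    using inj_on_tour[OF c] inj_on_tour[OF r] k by (simp add: sum.reindex)
  also have "\<dots> = sum ?w (?A \<union> ?B)"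
    using disj by (intro sum.union_disjoint[symmetric]) auto
  also have "\<dots> \<le> sum ?w ?T"
    using sub by (intro sum_mono2) (auto simp: finite_greedy fin_ext greedy_weight_def prod_nonneg)
  finally show ?thesis .
qed

lemma card_cyclic_labelled_sets_le:
  assumes k: "5 \<le> k" and fin: "finite V"
    and lab: "\<And>S. S \<in> F \<Longrightarrow> S \<subseteq> V \<and> (\<exists>c. cyclic_labelling E k c \<and> range c = S)"
  shows "real (card F) \<le> 2 * real (card V) ^ k / real k ^ k"
proof (cases "F = {}")
  case True
  then show ?thesis by simp
next
  case False
  let ?w = "greedy_weight (extensions V E k)" and ?T = "greedy (extensions V E k) k"
  have fin_ext: "finite (extensions V E k xs)" for xs
    using fin by (simp add: extensions_def)
  have finT: "finite ?T" by (rule finite_greedy[OF fin_ext])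
  have finF: "finite F"
    using lab fin by (intro finite_subset[of F "Pow V"]) auto
  have "V \<noteq> {}" using False lab by blast
  then have n: "card V > 0" using fin by (simp add: card_gt_0_iff)
  have "real (card F) * (real k ^ k / (2 * real (card V) ^ k))
      = (\<Sum>S\<in>F. real k ^ k / (2 * real (card V) ^ k))" by simp
  also have "\<dots> \<le> (\<Sum>S\<in>F. \<Sum>xs\<in>{xs \<in> ?T. set xs = S}. ?w xs)"
  proof (rule sum_mono)
    fix S assume "S \<in> F"
    then obtain c where "cyclic_labelling E k c" "range c = S" "S \<subseteq> V" using lab by blast
    then show "real k ^ k / (2 * real (card V) ^ k) \<le> (\<Sum>xs\<in>{xs \<in> ?T. set xs = S}. ?w xs)"
      using sum_weights_of_cycle_ge[OF k fin] by blast
  qed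
  also have "\<dots> = sum ?w (\<Union>S\<in>F. {xs \<in> ?T. set xs = S})"
    using finF finT by (intro sum.UNION_disjoint[symmetric]) auto
  also have "\<dots> \<le> sum ?w ?T"
    using finT by (intro sum_mono2) (auto simp: greedy_weight_def prod_nonneg)
  also have "\<dots> \<le> 1" by (rule sum_greedy_weight_le_1[OF fin_ext])
  finally show ?thesis using n k by (simp add: field_simps)
qed

section \<open>From isomorphisms to labellings\<close>

lemma arcs_ends_induce_subgraph:
  "arcs_ends (G \<restriction> S) = arcs_ends G \<inter> S \<times> S"
  by (auto simp: arcs_ends_conv)

lemma cyclic_labelling_of_iso:
  assumes iso: "digraph_iso (G \<restriction> S) (cycle_graph k)" and k: "3 \<le> k"
  shows "\<exists>c. cyclic_labelling (arcs_ends G) k c \<and> range c = S"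
proof -
  obtain h where h: "pre_digraph.digraph_isomorphism (G \<restriction> S) h"
    and eq: "cycle_graph k = app_iso h (G \<restriction> S)"
    using iso by (auto simp: digraph_iso_def)
  have wf: "wf_digraph (G \<restriction> S)"
    using h by (simp add: pre_digraph.digraph_isomorphism_def)
  define f where "f = iso_verts h"
  have inj: "inj_on f S"
    using pre_digraph.digraph_isomorphism_inj_on_verts[OF h] by (simp add: f_def)
  have "verts (cycle_graph k) = f ` S" unfolding eq by (simp add: f_def)
  then have img: "f ` S = {0..<k}" by (simp add: cycle_graph_def)
  have "arcs_ends (cycle_graph k) = (\<lambda>(u, v). (f u, f v)) ` (arcs_ends G \<inter> S \<times> S)"
    unfolding eq wf_digraph.arcs_ends_app_iso_eq[OF wf h] arcs_ends_induce_subgraph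
    by (simp add: f_def)
  then have arcs: "{(i, j). i < k \<and> j < k \<and> (j = (i + 1) mod k \<or> i = (j + 1) mod k)}
      = (\<lambda>(u, v). (f u, f v)) ` (arcs_ends G \<inter> S \<times> S)"
    by (simp add: cycle_graph_def)
  define g where "g = inv_into S f"
  have gS: "g a \<in> S" and fg: "f (g a) = a" if "a < k" for a
    using that img by (auto simp: g_def inv_into_into f_inv_into_f)
  have gf: "g (f u) = u" if "u \<in> S" for u
    using that inj by (simp add: g_def)
  have adj: "(g a, g b) \<in> arcs_ends G \<longleftrightarrow> b = (a + 1) mod k \<or> a = (b + 1) mod k"
    if "a < k" "b < k" for a b
  proof -
    have "(g a, g b) \<in> arcs_ends G \<longleftrightarrow> (a, b) \<in> (\<lambda>(u, v). (f u, f v)) ` (arcs_ends G \<inter> S \<times> S)"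
    proof
      assume "(g a, g b) \<in> arcs_ends G"
      with that show "(a, b) \<in> (\<lambda>(u, v). (f u, f v)) ` (arcs_ends G \<inter> S \<times> S)"
        by (intro rev_image_eqI[of "(g a, g b)"]) (simp_all add: gS fg)
    next
      assume "(a, b) \<in> (\<lambda>(u, v). (f u, f v)) ` (arcs_ends G \<inter> S \<times> S)"
      then obtain u v where "(u, v) \<in> arcs_ends G" "u \<in> S" "v \<in> S" "a = f u" "b = f v"
        by auto
      then show "(g a, g b) \<in> arcs_ends G" by (simp add: gf)
    qed
    then show ?thesis unfolding arcs[symmetric] using that by simp
  qed
  define c where "c i = g (nat (i mod int k))" for i
  have lt: "nat (i mod int k) < k" for i using k by (simp add: nat_less_iff)
  have "c i = c j \<longleftrightarrow> i mod int k = j mod int k" for i j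
  proof -
    have "c i = c j \<longleftrightarrow> nat (i mod int k) = nat (j mod int k)"
      unfolding c_def using fg[OF lt] by metis
    then show ?thesis using k by (simp add: eq_nat_nat_iff)
  qed
  moreover have "(c i, c j) \<in> arcs_ends G \<longleftrightarrow> (i - j) mod int k = 1 \<or> (j - i) mod int k = 1" for i j
  proof -
    have *: "nat (j mod int k) = (nat (i mod int k) + 1) mod k \<longleftrightarrow> (j - i) mod int k = 1" for i j
    proof -
      have "nat (j mod int k) = (nat (i mod int k) + 1) mod k
          \<longleftrightarrow> int (nat (j mod int k)) = int ((nat (i mod int k) + 1) mod k)"
        by (simp only: of_nat_eq_iff)
      also have "\<dots> \<longleftrightarrow> j mod int k = (i + 1) mod int k"
        using k by (simp add: zmod_int mod_simps add.commute)
      also have "\<dots> \<longleftrightarrow> (j - i) mod int k = 1 mod int k"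
        by (simp add: mod_eq_dvd_iff algebra_simps)
      also have "1 mod int k = 1" using k by simp
      finally show ?thesis .
    qed
    show ?thesis unfolding c_def adj[OF lt lt] * by blast
  qed
  moreover have "range c = S"
  proof
    show "range c \<subseteq> S" using gS[OF lt] by (auto simp: c_def)
    show "S \<subseteq> range c"
    proof
      fix u assume u: "u \<in> S"
      then have "f u < k" using img by auto
      then have "c (int (f u)) = u" using gf[OF u] by (simp add: c_def)
      then show "u \<in> range c" by (metis rangeI)
    qed
  qed
  ultimately show ?thesis by (auto simp: cyclic_labelling_def)
qed

theorem theorem1:
  fixes G :: "('a, 'b) pre_digraph" and k n :: nat
  assumes "5 \<le> k"
    and "graph G"
    and "card (verts G) = n"
  shows "real (induced_cycle_count G k) \<le> 2 * real n ^ k / real k ^ k"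
proof -
  interpret graph G by fact
  show ?thesis
    unfolding induced_cycle_count_def assms(3)[symmetric]
    using cyclic_labelling_of_iso[of G _ k] assms(1)
    by (intro card_cyclic_labelled_sets_le[where E = "arcs_ends G"]) auto
qed

end
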